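(* Let $K$ be a closed convex cone in a finite dimensional Euclidean space $X$, and let $F$ be a face of $K$. Then the following statements are equivalent: (1) $F^* = K^* + F^\perp$. (2) $K^* \cap \operatorname{ri} H \neq \emptyset$ holds for every face $H$ of $F^*$. (3) $K^* \cap H \supsetneq K^* \cap F^\perp$ holds for every properly minimal face $H$ of $F^*$.
   Context: All spaces are finite dimensional Euclidean spaces with inner product $\langle\cdot,\cdot\rangle$. A cone is a nonempty set $C$ with $\lambda x\in C$ for all $x\in C$, $\lambda\ge 0$. For a convex cone $C\subseteq X$: the dual cone is $C^*=\{y\in X : \langle y,x\rangle\ge 0 \ \forall x\in C\}$; the lineality space is $\operatorname{lspace} C = C\cap(-C)$. For a set $S$, $S^\perp$ is the orthogonal complement in $X$ of the linear span of $S$; $\operatorname{ri}$ denotes relative interior. For a face $F$ of $K$, $F^*$ is the dual cone of $F$ taken in the whole space $X$. A nonempty convex subset $E$ of a closed convex cone $C$ is a face of $C$ if $x_1,x_2\in C$ and $x_1+x_2\in E$ imply $x_1,x_2\in E$; equivalently, whenever the open line segment between $x_1,x_2\in C$ meets $E$, both $x_1,x_2\in E$. The cone $C$ itself is a face, and $\operatorname{lspace} C$ is the inclusionwise smallest face. A face $E$ of $C$ is properly minimal if $E\neq \operatorname{lspace} C$ and there is no face $E'$ of $C$ with $\operatorname{lspace} C\subsetneq E'\subsetneq E$. *)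

theory Defs
  imports "HOL-Analysis.Analysis"
begin

definition dual_cone :: "'a::euclidean_space set \<Rightarrow> 'a set"
  where "dual_cone C = {y. \<forall>x\<in>C. y \<bullet> x \<ge> 0}"

definition lspace :: "'a::euclidean_space set \<Rightarrow> 'a set"
  where "lspace C = C \<inter> uminus ` C"

(* The empty set is a library face of every set, but not a face of a cone. *)
definition cone_face :: "'a::euclidean_space set \<Rightarrow> 'a set \<Rightarrow> bool"
  where "cone_face E C \<longleftrightarrow> E \<noteq> {} \<and> E face_of C"

definition properly_minimal_face :: "'a::euclidean_space set \<Rightarrow> 'a set \<Rightarrow> bool"
  where "properly_minimal_face E C \<longleftrightarrow>
    cone_face E C \<and> E \<noteq> lspace C \<and>
    \<not> (\<exists>E'. cone_face E' C \<and> lspace C \<subset> E' \<and> E' \<subset> E)"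

(* The open-segment description of faces agrees with the one by sums. In the latter E must be
   required to be a cone: the segment [0,1] is convex and satisfies the sum condition in the
   cone of nonnegative reals, but violates the segment condition. *)
lemma cone_face_iff_sum:
  assumes C: "convex_cone C"
  shows "cone_face E C \<longleftrightarrow>
    convex_cone E \<and> E \<subseteq> C \<and> (\<forall>x\<in>C. \<forall>y\<in>C. x + y \<in> E \<longrightarrow> x \<in> E \<and> y \<in> E)"
    (is "?L \<longleftrightarrow> ?R")
proof
  assume L: ?L
  then have ne: "E \<noteq> {}" and f: "E face_of C" by (auto simp: cone_face_def)
  have "conic E" using face_of_conic C f by (auto simp: convex_cone_def)
  then have cE: "convex_cone E" using f ne by (auto simp: convex_cone_def face_of_def)
  moreover have "x \<in> E \<and> y \<in> E" if "x \<in> C" "y \<in> C" "x + y \<in> E" for x y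
  proof (cases "x = y")
    case True
    then have "x + y = 2 *\<^sub>R x" by (simp add: scaleR_2)
    then have "(1/2) *\<^sub>R (2 *\<^sub>R x) \<in> E"
      using convex_cone_scaleR[OF cE, of "1/2" "x + y"] that by simp
    then show ?thesis using True by simp
  next
    case False
    have "(1/2) *\<^sub>R (x + y) \<in> E"
      using convex_cone_scaleR[OF cE, of "1/2" "x + y"] that(3) by simp
    moreover have "(1/2) *\<^sub>R (x + y) \<in> open_segment x y"
      using False midpoint_in_open_segment[of x y] by (simp add: midpoint_def)
    ultimately show ?thesis using face_ofD[OF f _ that(1,2)] by blast
  qed
  ultimately show ?R using f by (auto simp: face_of_def)
next
  assume R: ?R
  have "a \<in> E \<and> b \<in> E"
    if a: "a \<in> C" and b: "b \<in> C" and x: "x \<in> E" "x \<in> open_segment a b" for a b x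
  proof -
    obtain u where u: "0 < u" "u < 1" and xe: "x = (1 - u) *\<^sub>R a + u *\<^sub>R b"
      using x(2) by (auto simp: in_segment)
    have "(1 - u) *\<^sub>R a \<in> C" "u *\<^sub>R b \<in> C"
      using convex_cone_scaleR[OF C, of "1 - u" a] convex_cone_scaleR[OF C, of u b] a b u by simp_all
    then have "(1 - u) *\<^sub>R a \<in> E" "u *\<^sub>R b \<in> E"
      using R x(1) unfolding xe by blast+
    then have "(1 / (1 - u)) *\<^sub>R ((1 - u) *\<^sub>R a) \<in> E" "(1 / u) *\<^sub>R (u *\<^sub>R b) \<in> E"
      using R u convex_cone_scaleR[of E "1 / (1 - u)" "(1 - u) *\<^sub>R a"]
        convex_cone_scaleR[of E "1 / u" "u *\<^sub>R b"]
      by (simp_all del: scaleR_scaleR)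
    then show ?thesis using u by simp
  qed
  then have "\<forall>a\<in>C. \<forall>b\<in>C. \<forall>x\<in>E. x \<in> open_segment a b \<longrightarrow> a \<in> E \<and> b \<in> E"
    by blast
  moreover have "E \<noteq> {}" "E \<subseteq> C" "convex E"
    using R unfolding convex_cone_def by blast+
  ultimately show ?L unfolding cone_face_def face_of_def by blast
qed

end

theory Submission
  imports Defs
begin

text \<open>
  Write \<open>D\<close> for the dual cone of \<open>F\<close>.  It is a closed convex cone whose lineality space is
  \<open>F\<^sup>\<bottom>\<close>, and it contains \<open>K\<^sup>* + F\<^sup>\<bottom>\<close> because \<open>F \<subseteq> K\<close>.  The equality
  \<open>D = K\<^sup>* + F\<^sup>\<bottom>\<close> thus says that, up to lineality vectors, every element of \<open>D\<close> comes from
  \<open>K\<^sup>*\<close>.  The three conditions are linked in a circle.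

  Suppose that the equality holds, and let \<open>h\<close> be a relative interior point of a face \<open>H\<close> of \<open>D\<close>.
  Then \<open>h = k + l\<close> with \<open>k \<in> K\<^sup>*\<close> and \<open>l\<close> in the lineality space.  A face, and with it its relative
  interior, is invariant under lineality translations (\<open>rel_interior_face_minus_lspace\<close>), so
  \<open>k = h - l\<close> is a relative interior point of \<open>H\<close> as well.

  Suppose next that \<open>K\<^sup>*\<close> meets the relative interior of each face.  The lineality space is a proper
  face of a properly minimal face \<open>H\<close>, hence misses the relative interior of \<open>H\<close>; so \<open>K\<^sup>*\<close> has
  a point in \<open>H\<close> outside the lineality space.

  Suppose finally that each properly minimal face has such a point.  It generates the face together
  with the lineality space (\<open>properly_minimal_face_decomposition\<close>), so that
  \<open>K\<^sup>* + F\<^sup>\<bottom>\<close> contains all properly minimal faces.  It then contains \<open>D\<close>, since a closed convex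
  cone lies in every convex cone that contains its lineality space and its properly minimal faces
  (\<open>closed_cone_subset_if_minimal_faces_subset\<close>); modulo the lineality space this is the generation
  of a closed pointed cone by its extreme rays.  Both lemmas rest on
  \<open>subtract_into_proper_face\<close>, which avoids passing to the quotient by the lineality space.
\<close>

section \<open>The lineality space and faces\<close>

lemma lspace_iff: "x \<in> lspace C \<longleftrightarrow> x \<in> C \<and> - x \<in> C"
  by (auto simp: lspace_def image_iff) (metis minus_minus)

lemma cone_face_lspace:
  assumes C: "convex_cone C"
  shows "cone_face (lspace C) C"
proof -
  have "convex_cone (lspace C)"
    using convex_cone_Inter[of "{C, uminus ` C}"] C convex_cone_negations[OF C]
    by (auto simp: lspace_def)
  moreover have left: "x \<in> lspace C" if "x \<in> C" "y \<in> C" "x + y \<in> lspace C" for x y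
  proof -
    have "y + - (x + y) \<in> C"
      using that convex_cone_add[OF C] by (simp only: lspace_iff)
    then show ?thesis using that by (simp add: lspace_iff)
  qed
  moreover have "y \<in> lspace C" if "x \<in> C" "y \<in> C" "x + y \<in> lspace C" for x y
    using left[of y x] that by (simp add: add.commute)
  moreover have "lspace C \<subseteq> C" by (auto simp: lspace_def)
  ultimately show ?thesis unfolding cone_face_iff_sum[OF C] by blast
qed

lemma lspace_subset_cone_face:
  assumes C: "convex_cone C" and E: "cone_face E C"
  shows "lspace C \<subseteq> E"
proof
  fix l assume "l \<in> lspace C"
  then have "l \<in> C" "- l \<in> C" by (auto simp: lspace_iff)
  moreover have "l + - l \<in> E"
    using E convex_cone_contains_0[of E] by (simp add: cone_face_iff_sum[OF C])
  ultimately show "l \<in> E" using E unfolding cone_face_iff_sum[OF C] by blast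
qed

lemma rel_interior_face_minus_lspace:
  assumes C: "convex_cone C" and H: "cone_face H C"
    and h: "h \<in> rel_interior H" and l: "l \<in> lspace C"
  shows "h - l \<in> rel_interior H"
proof -
  have cH: "convex_cone H" using H cone_face_iff_sum[OF C] by blast
  have "- l \<in> lspace C" using l by (simp add: lspace_iff)
  then have lH: "l \<in> H" "- l \<in> H" using l lspace_subset_cone_face[OF C H] by auto
  have "(+) (- l) ` H = H"
  proof (intro equalityI subsetI)
    fix x assume "x \<in> (+) (- l) ` H"
    then show "x \<in> H" using convex_cone_add[OF cH lH(2)] by auto
  next
    fix x assume "x \<in> H"
    then have "l + x \<in> H" using convex_cone_add[OF cH] lH by auto
    then show "x \<in> (+) (- l) ` H" by (intro image_eqI[of _ _ "l + x"]) auto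
  qed
  then have "(+) (- l) ` rel_interior H = rel_interior H"
    by (metis rel_interior_translation)
  then have "- l + h \<in> rel_interior H" using h by blast
  then show ?thesis by simp
qed

section \<open>Generation of a closed cone by its properly minimal faces\<close>

text \<open>
  Moving from \<open>x\<close> in the direction \<open>- e\<close> leaves the cone, for otherwise \<open>- e\<close> would be a limit of
  elements \<open>x / n - e\<close> of the cone.  The last point of the half-line in the cone is not in the
  relative interior, so a supporting hyperplane at that point cuts out a proper face.
\<close>

lemma subtract_into_proper_face:
  fixes E :: "'a::euclidean_space set"
  assumes E: "convex_cone E" "closed E" and e: "e \<in> E" "- e \<notin> E" and x: "x \<in> E"
  obtains s G where "s \<ge> 0" "G face_of E" "G \<noteq> E" "x - s *\<^sub>R e \<in> G"
proof -
  obtain t where t: "t \<ge> 0" "x - t *\<^sub>R e \<notin> E"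
  proof (rule ccontr)
    assume "\<not> thesis"
    with that have all: "x - t *\<^sub>R e \<in> E" if "t \<ge> 0" for t using \<open>t \<ge> 0\<close> by blast
    have "inverse (real (Suc n)) *\<^sub>R x - e \<in> E" for n
    proof -
      have "inverse (real (Suc n)) *\<^sub>R (x - real (Suc n) *\<^sub>R e) \<in> E"
        using all[of "real (Suc n)"] convex_cone_scaleR[OF E(1)] by simp
      then show ?thesis by (simp add: scaleR_diff_right del: of_nat_Suc)
    qed
    moreover have "(\<lambda>n. inverse (real (Suc n)) *\<^sub>R x - e) \<longlonglongrightarrow> 0 *\<^sub>R x - e"
      by (intro tendsto_intros LIMSEQ_inverse_real_of_nat)
    ultimately have "0 *\<^sub>R x - e \<in> E"
      by (rule closed_sequentially[OF E(2)])
    then show False using e by simp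
  qed
  define A where "A = {0..} \<inter> (\<lambda>s. x - s *\<^sub>R e) -` E"
  have "A \<subseteq> {0..t}"
  proof
    fix s assume s: "s \<in> A"
    have "s \<le> t"
    proof (rule ccontr)
      assume "\<not> s \<le> t"
      then have "(x - s *\<^sub>R e) + (s - t) *\<^sub>R e \<in> E"
        using s e
        by (intro convex_cone_add[OF E(1)] convex_cone_scaleR[OF E(1)]) (auto simp: A_def)
      then show False using t by (simp add: algebra_simps)
    qed
    then show "s \<in> {0..t}" using s by (auto simp: A_def)
  qed
  moreover have "closed A"
    unfolding A_def by (intro closed_Int continuous_closed_vimage E) (auto intro!: continuous_intros)
  ultimately have "compact A"
    using bounded_subset compact_eq_bounded_closed by blast
  moreover have "A \<noteq> {}" using x by (auto simp: A_def)
  ultimately obtain s where s: "s \<in> A" and s_max: "\<And>r. r \<in> A \<Longrightarrow> r \<le> s"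
    by (metis compact_attains_sup)
  define y where "y = x - s *\<^sub>R e"
  have yE: "y \<in> E" and "s \<ge> 0" using s by (auto simp: A_def y_def)
  have "y \<notin> rel_interior E"
  proof
    \<comment> \<open>otherwise the segment from \<open>y + e\<close> to \<open>y\<close> could be prolonged beyond \<open>y\<close> inside \<open>E\<close>\<close>
    assume "y \<in> rel_interior E"
    moreover have "y + e \<in> affine hull E"
      using convex_cone_add[OF E(1) yE e(1)] by (simp add: hull_inc)
    ultimately obtain m where m: "m > 1" "(1 - m) *\<^sub>R (y + e) + m *\<^sub>R y \<in> E"
      using convex_rel_interior_if[of E y] E by (auto simp: convex_cone_def)
    then have "x - (s + (m - 1)) *\<^sub>R e \<in> E" by (simp add: y_def algebra_simps)
    then have "s + (m - 1) \<in> A" using m \<open>s \<ge> 0\<close> by (simp add: A_def)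
    then show False using s_max[of "s + (m - 1)"] m by simp
  qed
  then obtain a where a: "\<And>z. z \<in> E \<Longrightarrow> a \<bullet> y \<le> a \<bullet> z"
      "\<And>z. z \<in> rel_interior E \<Longrightarrow> a \<bullet> y < a \<bullet> z"
    using supporting_hyperplane_rel_boundary[of E y] yE E
    by (metis convex_cone_def)
  let ?G = "E \<inter> {z. a \<bullet> z = a \<bullet> y}"
  have "?G face_of E"
    using a(1) E by (intro face_of_Int_supporting_hyperplane_ge) (auto simp: convex_cone_def)
  moreover have "?G \<noteq> E"
  proof -
    obtain z where z: "z \<in> rel_interior E"
      using rel_interior_eq_empty[of E] E by (auto simp: convex_cone_def)
    have "z \<in> E" using z rel_interior_subset by blast
    moreover have "z \<notin> ?G" using a(2)[OF z] by simp
    ultimately show ?thesis by metis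
  qed
  ultimately show ?thesis using that[of s ?G] \<open>s \<ge> 0\<close> yE by (simp add: y_def)
qed

text \<open>
  The only nonempty proper face of a properly minimal face is the lineality space, so subtracting a multiple of
  \<open>k\<close> to reach a proper face leaves only a lineality vector.
\<close>

lemma properly_minimal_face_decomposition:
  assumes C: "convex_cone C" "closed C" and H: "properly_minimal_face H C"
    and k: "k \<in> H" "k \<notin> lspace C" and x: "x \<in> H"
  obtains s where "s \<ge> 0" "x - s *\<^sub>R k \<in> lspace C"
proof -
  have fH: "cone_face H C" using H by (simp add: properly_minimal_face_def)
  then have cH: "convex_cone H" and HC: "H \<subseteq> C" using cone_face_iff_sum[OF C(1)] by auto
  have clH: "closed H"
    using face_of_imp_closed[of C H] C fH by (simp add: cone_face_def convex_cone_def)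
  have "- k \<notin> H" using k HC by (auto simp: lspace_iff)
  then obtain s G where s: "s \<ge> 0" and G: "G face_of H" "G \<noteq> H" "x - s *\<^sub>R k \<in> G"
    using subtract_into_proper_face[OF cH clH k(1) _ x] by blast
  have fG: "cone_face G C"
    using G fH face_of_trans by (auto simp: cone_face_def)
  have "G \<subset> H" using G face_of_imp_subset by blast
  then have "G = lspace C"
    using H fG lspace_subset_cone_face[OF C(1) fG] unfolding properly_minimal_face_def by blast
  then show ?thesis using s G that by blast
qed

text \<open>
  Induction on the dimension of a face \<open>E\<close> of \<open>C\<close>.  If \<open>E\<close> is neither the lineality space nor
  properly minimal, some smaller face contains a vector \<open>e\<close> outside the lineality space, and each
  \<open>x \<in> E\<close> is the sum of a multiple of \<open>e\<close> and a point of a proper face of \<open>E\<close>.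
\<close>

lemma closed_cone_subset_if_minimal_faces_subset:
  assumes C: "convex_cone C" "closed C" and S: "convex_cone S"
    and L: "lspace C \<subseteq> S" and min: "\<And>H. properly_minimal_face H C \<Longrightarrow> H \<subseteq> S"
  shows "C \<subseteq> S"
proof -
  have "E \<subseteq> S" if "cone_face E C" for E
    using that
  proof (induction "nat (aff_dim E)" arbitrary: E rule: less_induct)
    case less
    note fE = less.prems
    have cE: "convex_cone E" and EC: "E \<subseteq> C"
      using fE cone_face_iff_sum[OF C(1)] by auto
    have clE: "closed E"
      using face_of_imp_closed[of C E] C fE by (simp add: cone_face_def convex_cone_def)
    have smaller: "G \<subseteq> S" if G: "G face_of E" "G \<noteq> E" "G \<noteq> {}" for G
    proof (rule less.hyps)
      have "aff_dim G < aff_dim E"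
        using face_of_aff_dim_lt G cE by (auto simp: convex_cone_def)
      moreover have "0 \<le> aff_dim G" using G(3) aff_dim_negative_iff[of G] by linarith
      ultimately show "nat (aff_dim G) < nat (aff_dim E)" by simp
      show "cone_face G C" using G fE face_of_trans by (auto simp: cone_face_def)
    qed
    show ?case
    proof (cases "E = lspace C \<or> properly_minimal_face E C")
      case True
      then show ?thesis using L min by blast
    next
      case False
      then obtain E' where E': "cone_face E' C" "lspace C \<subset> E'" "E' \<subset> E"
        using fE unfolding properly_minimal_face_def by blast
      then obtain e where e: "e \<in> E'" "e \<notin> lspace C" by blast
      have "E' face_of E"
        using E' EC face_of_subset[of E' C E] by (auto simp: cone_face_def)
      then have "E' \<subseteq> S" using smaller E' e by blast
      have "e \<in> E" "- e \<notin> E" using e E' EC by (auto simp: lspace_iff)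
      show ?thesis
      proof
        fix x assume "x \<in> E"
        then obtain s G where G: "s \<ge> 0" "G face_of E" "G \<noteq> E" "x - s *\<^sub>R e \<in> G"
          using subtract_into_proper_face[OF cE clE \<open>e \<in> E\<close> \<open>- e \<notin> E\<close>] by blast
        then have "x - s *\<^sub>R e \<in> S" using smaller by blast
        moreover have "s *\<^sub>R e \<in> S"
          using \<open>E' \<subseteq> S\<close> e G convex_cone_scaleR[OF S] by blast
        ultimately have "(x - s *\<^sub>R e) + s *\<^sub>R e \<in> S" using convex_cone_add[OF S] by blast
        then show "x \<in> S" by simp
      qed
    qed
  qed
  moreover have "cone_face C C"
    using C(1) by (auto simp: cone_face_def convex_cone_def face_of_refl)
  ultimately show ?thesis by blast
qed

section \<open>Dual cones of faces\<close>

lemma convex_cone_dual_cone: "convex_cone (dual_cone C)"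
  by (auto simp: convex_cone_iff dual_cone_def inner_add_left)

lemma closed_dual_cone: "closed (dual_cone C)"
proof -
  have "dual_cone C = (\<Inter>x\<in>C. {y. x \<bullet> y \<ge> 0})"
    by (auto simp: dual_cone_def inner_commute)
  then show ?thesis by (simp add: closed_INT closed_halfspace_ge)
qed

lemma lspace_dual_cone: "lspace (dual_cone F) = orthogonal_comp (span F)"
proof -
  have "y \<in> lspace (dual_cone F) \<longleftrightarrow> (\<forall>x\<in>F. orthogonal y x)" for y
    by (force simp: lspace_iff dual_cone_def orthogonal_def)
  also have "(\<forall>x\<in>F. orthogonal y x) \<longleftrightarrow> y \<in> orthogonal_comp (span F)" for y
    using orthogonal_to_span[of _ F y] span_base[of _ F]
    by (auto simp: orthogonal_comp_def orthogonal_commute)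
  finally show ?thesis by blast
qed

theorem theorem2:
  fixes K F :: "'a::euclidean_space set"
  assumes "convex_cone K" and "closed K" and "cone_face F K"
  shows "(dual_cone F = dual_cone K + orthogonal_comp (span F)
            \<longleftrightarrow> (\<forall>H. cone_face H (dual_cone F) \<longrightarrow> dual_cone K \<inter> rel_interior H \<noteq> {}))
       \<and> (dual_cone F = dual_cone K + orthogonal_comp (span F)
            \<longleftrightarrow> (\<forall>H. properly_minimal_face H (dual_cone F)
                  \<longrightarrow> dual_cone K \<inter> orthogonal_comp (span F) \<subset> dual_cone K \<inter> H))"
    (is "(?one \<longleftrightarrow> ?two) \<and> (_ \<longleftrightarrow> ?three)")
proof -
  define D where "D = dual_cone F"
  define L where "L = lspace D"
  have L_eq: "orthogonal_comp (span F) = L" by (simp add: L_def D_def lspace_dual_cone)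
  have D: "convex_cone D" "closed D"
    by (simp_all add: D_def convex_cone_dual_cone closed_dual_cone)
  have fL: "cone_face L D" unfolding L_def by (rule cone_face_lspace[OF D(1)])
  have cL: "convex_cone L" using fL cone_face_iff_sum[OF D(1)] by blast
  have "F \<subseteq> K" using assms(3) by (simp add: cone_face_def face_of_imp_subset)
  then have KD: "dual_cone K \<subseteq> D" by (auto simp: D_def dual_cone_def)
  have "?one \<Longrightarrow> ?two"
  proof (intro allI impI)
    fix H assume one: ?one and H: "cone_face H (dual_cone F)"
    then have fH: "cone_face H D" by (simp add: D_def)
    then have "rel_interior H \<noteq> {}"
      using rel_interior_eq_empty face_of_imp_convex by (auto simp: cone_face_def)
    then obtain h where h: "h \<in> rel_interior H" by blast
    then have "h \<in> D"
      using fH rel_interior_subset face_of_imp_subset unfolding cone_face_def by blast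
    then obtain k l where kl: "h = k + l" "k \<in> dual_cone K" "l \<in> L"
      using one by (auto simp: D_def[symmetric] L_eq set_plus_def)
    have "h - l \<in> rel_interior H"
      using rel_interior_face_minus_lspace[OF D(1) fH h, of l] kl by (simp add: L_def)
    then show "dual_cone K \<inter> rel_interior H \<noteq> {}" using kl by auto
  qed
  moreover have "?two \<Longrightarrow> ?three"
  proof (intro allI impI)
    fix H assume two: ?two and "properly_minimal_face H (dual_cone F)"
    then have fH: "cone_face H D" and ne: "H \<noteq> L"
      by (auto simp: D_def L_def properly_minimal_face_def)
    have LH: "L \<subseteq> H" using lspace_subset_cone_face[OF D(1) fH] by (simp add: L_def)
    obtain k where k: "k \<in> dual_cone K" "k \<in> rel_interior H"
      using two fH by (auto simp: D_def)
    have "L face_of H"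
      using face_of_subset[of L D H] fL fH LH by (auto simp: cone_face_def face_of_imp_subset)
    then have "k \<notin> L" using face_of_disjoint_rel_interior[of L H] ne k by blast
    moreover have "k \<in> H" using k rel_interior_subset by blast
    ultimately show "dual_cone K \<inter> orthogonal_comp (span F) \<subset> dual_cone K \<inter> H"
      using k LH unfolding L_eq by blast
  qed
  moreover have "?three \<Longrightarrow> ?one"
  proof -
    assume three: ?three
    let ?S = "dual_cone K + L"
    have S: "convex_cone ?S"
    proof -
      have "?S = (\<Union>k\<in>dual_cone K. \<Union>l\<in>L. {k + l})" by (auto simp: set_plus_def)
      then show ?thesis using convex_cone_sums[OF convex_cone_dual_cone[of K] cL] by simp
    qed
    have SI: "k + l \<in> ?S" if "k \<in> dual_cone K" "l \<in> L" for k l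
      using that by (rule set_plus_intro)
    have "D \<subseteq> ?S"
    proof (rule closed_cone_subset_if_minimal_faces_subset[OF D S])
      show "lspace D \<subseteq> ?S"
      proof
        fix l assume "l \<in> lspace D"
        then show "l \<in> ?S"
          using SI[of 0 l] convex_cone_contains_0[OF convex_cone_dual_cone[of K]]
          by (simp add: L_def)
      qed
      fix H assume H: "properly_minimal_face H D"
      obtain k where k: "k \<in> dual_cone K" "k \<in> H" "k \<notin> L"
        using three H unfolding L_eq D_def by blast
      show "H \<subseteq> ?S"
      proof
        fix x assume "x \<in> H"
        then obtain s where "s \<ge> 0" "x - s *\<^sub>R k \<in> L"
          using properly_minimal_face_decomposition[OF D H, of k x] k by (auto simp: L_def)
        then show "x \<in> ?S"
          using SI[of "s *\<^sub>R k" "x - s *\<^sub>R k"] k(1)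
            convex_cone_scaleR[OF convex_cone_dual_cone[of K], of s k]
          by simp
      qed
    qed
    moreover have "?S \<subseteq> D"
    proof -
      have "L \<subseteq> D" by (auto simp: L_def lspace_iff)
      then show ?thesis using KD convex_cone_add[OF D(1)] by (auto simp: set_plus_def)
    qed
    ultimately show ?one by (simp add: D_def[symmetric] L_eq)
  qed
  ultimately show ?thesis by blast
qed

end
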